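(* Let $(\xi_i)_{i\in\mathbb{Z}}$ be i.i.d. non-negative random variables with continuous distribution function $F$, and consider the associated infinite Page parking, with arrival times $\tau_i$ and continuous-time process $(X^t_\infty)_{t\ge 0}$. Then for every $i\in\mathbb{Z}$ and every $t\ge 0$, $$\mathbb{E}[X^t_\infty(i)]=\mathbb{P}(\tau_i\le t)=1-e^{-2F(t)}.$$
   Context: Definition of the infinite Page parking. The places are the elements of $\mathbb{Z}$. At time $\xi_i$ a car of length two tries to park on the pair of places $(i,i+1)$; it succeeds if and only if both places $i$ and $i+1$ are empty just before time $\xi_i$, and once parked it stays forever. Equivalently, let $P_i\in\{0,1\}$ be the indicator that the car trying to park at $(i,i+1)$ succeeds: $P_i=1$ if and only if, for each $j\in\{i-1,i+1\}$ with $\xi_j<\xi_i$, one has $P_j=0$. In particular $P_i=1$ whenever $i$ is a local minimum, i.e. $\xi_{i-1}>\xi_i<\xi_{i+1}$. Almost surely the $\xi_i$ are pairwise distinct and every integer has local minima of $\xi$ both on its left and on its right at finite distance, so that each $P_i$ is determined by finitely many of the $\xi_j$'s, and the rule defines all $P_i$ almost surely. Set $X_\infty(i)=1$ if $P_{i-1}=1$ or $P_i=1$ (place $i$ is eventually occupied by a car), and $X_\infty(i)=0$ otherwise. Arrival times: $\tau_i=\xi_{i-1}$ if the car eventually occupying place $i$ is parked at $(i-1,i)$ (i.e. $P_{i-1}=1$), $\tau_i=\xi_i$ if it is parked at $(i,i+1)$ (i.e. $P_i=1$), and $\tau_i=+\infty$ if there is no car at $i$ (i.e. $X_\infty(i)=0$).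 For $t\ge 0$, $X^t_\infty(i)=1$ if $X_\infty(i)=1$ and $\tau_i\le t$, and $X^t_\infty(i)=0$ otherwise. *)

theory Defs
  imports "HOL-Probability.Probability"
begin

text \<open>
  A configuration \<open>\<xi> :: int \<Rightarrow> real\<close> lists the times at which the cars try to park;
  \<open>parked \<xi> i\<close> says that the car trying the places \<open>i\<close>, \<open>i + 1\<close> succeeds.
  The recursion \<open>parks\<close> terminates on \<open>(\<xi>, i)\<close> as soon as \<open>\<xi>\<close> has local minima on both sides
  of \<open>i\<close> (lemma \<open>parks_dom_local_min\<close>), hence almost surely for i.i.d. continuous \<open>\<xi>\<close>.
  Where it does not terminate, \<open>parked\<close> is set to \<open>False\<close>.
\<close>

function (domintros) parks :: "(int \<Rightarrow> real) \<Rightarrow> int \<Rightarrow> bool" where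
  "parks \<xi> i \<longleftrightarrow> (\<forall>j\<in>{i - 1, i + 1}. \<xi> j < \<xi> i \<longrightarrow> \<not> parks \<xi> j)"
  by pat_completeness auto

definition parked :: "(int \<Rightarrow> real) \<Rightarrow> int \<Rightarrow> bool" where
  "parked \<xi> i \<longleftrightarrow> parks_dom (\<xi>, i) \<and> parks \<xi> i"

definition local_min :: "(int \<Rightarrow> real) \<Rightarrow> int \<Rightarrow> bool" where
  "local_min \<xi> i \<longleftrightarrow> \<xi> (i - 1) > \<xi> i \<and> \<xi> i < \<xi> (i + 1)"

lemma parks_dom_local_min:
  assumes "local_min \<xi> a" "local_min \<xi> b" "a \<le> i" "i \<le> b"
  shows "parks_dom (\<xi>, i)"
  using assms(3,4)
proof (induction "card {k\<in>{a..b}. \<xi> k < \<xi> i}" arbitrary: i rule: less_induct)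
  case less
  have step: "parks_dom (\<xi>, j)" if j: "j \<in> {i - 1, i + 1}" "\<xi> j < \<xi> i" for j
  proof -
    have "i \<noteq> a" if "j = i - 1" using j that assms(1) by (auto simp: local_min_def)
    moreover have "i \<noteq> b" if "j = i + 1" using j that assms(2) by (auto simp: local_min_def)
    ultimately have ab: "a \<le> j" "j \<le> b" using j(1) less.prems by auto
    have "{k\<in>{a..b}. \<xi> k < \<xi> j} \<subset> {k\<in>{a..b}. \<xi> k < \<xi> i}"
      using ab j(2) by force
    then have "card {k\<in>{a..b}. \<xi> k < \<xi> j} < card {k\<in>{a..b}. \<xi> k < \<xi> i}"
      by (rule psubset_card_mono[rotated]) (rule finite_subset[of _ "{a..b}"], auto)
    from less.hyps[OF this ab] show ?thesis .
  qed
  show ?case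
    by (rule parks.domintros) (use step in auto)
qed

lemma parked_rule:
  assumes "local_min \<xi> a" "local_min \<xi> b" "a \<le> i" "i \<le> b"
  shows "parked \<xi> i \<longleftrightarrow> (\<forall>j\<in>{i - 1, i + 1}. \<xi> j < \<xi> i \<longrightarrow> \<not> parked \<xi> j)"
proof -
  have dom: "parks_dom (\<xi>, i)"
    using assms by (rule parks_dom_local_min)
  have "parks_dom (\<xi>, j)" if "j \<in> {i - 1, i + 1}" "\<xi> j < \<xi> i" for j
    using dom by (rule accp_downward) (use that in \<open>auto intro: parks_rel.intros\<close>)
  with dom show ?thesis
    unfolding parked_def parks.psimps[OF dom] by blast
qed

definition X_inf :: "(int \<Rightarrow> real) \<Rightarrow> int \<Rightarrow> real" where
  "X_inf \<xi> i = (if parked \<xi> (i - 1) \<or> parked \<xi> i then 1 else 0)"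

text \<open>
  At most one of \<open>parked \<xi> (i - 1)\<close>, \<open>parked \<xi> i\<close> holds when the times are pairwise
  distinct, so the order of the tests below is immaterial almost surely.
\<close>

definition arrival :: "(int \<Rightarrow> real) \<Rightarrow> int \<Rightarrow> ereal" where
  "arrival \<xi> i =
    (if parked \<xi> (i - 1) then ereal (\<xi> (i - 1))
     else if parked \<xi> i then ereal (\<xi> i)
     else \<infinity>)"

definition X_time :: "real \<Rightarrow> (int \<Rightarrow> real) \<Rightarrow> int \<Rightarrow> real" where
  "X_time t \<xi> i = (if X_inf \<xi> i = 1 \<and> arrival \<xi> i \<le> ereal t then 1 else 0)"

end

theory Submission
  imports Defs
begin

text \<open>
  Starting at a car and walking away from it in one direction, consider the maximal run of strictly
  decreasing attempt times. The last car of the run meets no earlier rival ahead of it, so,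
  undisturbed from behind, it parks; the one before it is then blocked, the next one parks, and
  so on. Hence a car parks exactly when both runs issuing from it, to the right and to the left,
  are finite and have even length (\<open>parked_iff_even_runs\<close>).

  For the place \<open>i\<close> this decouples the two sides. Only the cars \<open>i\<close> and \<open>i - 1\<close> can cover it, and
  until one of them has parked they do not interact. So, when the runs are finite, \<open>i\<close> is covered by time \<open>t\<close> if and
  only if \<open>\<xi> i \<le> t\<close> and the run \<open>\<xi> i > \<xi> (i + 1) > \<dots>\<close> to the right has even length, or
  \<open>\<xi> (i - 1) \<le> t\<close> and the run \<open>\<xi> (i - 1) > \<xi> (i - 2) > \<dots>\<close> to the left has even length
  (\<open>arrival_le_iff\<close>). These two events depend on disjoint families of times, so they are independent.

  The probability of \<open>t > \<xi> 0 > \<dots> > \<xi> k\<close> is \<open>F t ^ (k + 1) / (k + 1)!\<close>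
  (\<open>emeasure_descents\<close>): the \<open>F (\<xi> j)\<close> are independent and uniform on \<open>[0, 1]\<close>, and this is the volume
  of a simplex. Taking the alternating sum over \<open>k\<close>, each of the two events has probability
  \<open>1 - exp (- F t)\<close>, so the place is empty at time \<open>t\<close> with probability
  \<open>exp (- F t) * exp (- F t)\<close>. The formula \<open>F t ^ (k + 1) / (k + 1)!\<close>, tending to \<open>0\<close> as \<open>k\<close> grows, shows that all
  runs are finite almost surely.
\<close>

section \<open>Descending runs and the parking rule\<close>

definition descent_run :: "(nat \<Rightarrow> real) \<Rightarrow> nat \<Rightarrow> bool" where
  "descent_run x k \<longleftrightarrow> (\<forall>m<k. x (Suc m) < x m) \<and> \<not> x (Suc k) < x k"

definition even_run :: "(nat \<Rightarrow> real) \<Rightarrow> bool" where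
  "even_run x \<longleftrightarrow> (\<exists>k. even k \<and> descent_run x k)"

lemma descent_run_unique:
  assumes "descent_run x k" "descent_run x l"
  shows "k = l"
  using assms unfolding descent_run_def by (meson linorder_neqE_nat)

lemma descent_run_0 [simp]: "descent_run x 0 \<longleftrightarrow> \<not> x (Suc 0) < x 0"
  by (simp add: descent_run_def)

lemma descent_run_Suc:
  "descent_run x (Suc k) \<longleftrightarrow> x (Suc 0) < x 0 \<and> descent_run (\<lambda>m. x (Suc m)) k"
  by (auto simp: descent_run_def less_Suc_eq_0_disj)

lemma even_run_trivial: "\<not> x (Suc 0) < x 0 \<Longrightarrow> even_run x"
  unfolding even_run_def by (rule exI[of _ 0]) simp

text \<open>
  This recursion is the parking rule as seen by a car with a rival on one side only, which is why
  evenness of the run decides whether such a car parks. It fails for an infinite run, where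
  \<open>even_run\<close> is false for the sequence and for all its shifts.
\<close>

lemma even_run_step:
  assumes "descent_run x k"
  shows "even_run x \<longleftrightarrow> (x (Suc 0) < x 0 \<longrightarrow> \<not> even_run (\<lambda>m. x (Suc m)))"
proof (cases k)
  case 0
  then show ?thesis using assms even_run_trivial by auto
next
  case (Suc l)
  then have l: "x (Suc 0) < x 0" "descent_run (\<lambda>m. x (Suc m)) l"
    using assms by (auto simp: descent_run_Suc)
  have "even_run x \<longleftrightarrow> even k"
    unfolding even_run_def using assms descent_run_unique by blast
  moreover have "even_run (\<lambda>m. x (Suc m)) \<longleftrightarrow> even l"
    unfolding even_run_def using l(2) descent_run_unique by blast
  ultimately show ?thesis using l(1) Suc by simp
qed

text \<open>
  The recursion started at \<open>j\<close> consults earlier cars only, so once it has stepped in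
  direction \<open>d\<close> it can never turn back, and it stops at the end of the run. The hypothesis on
  \<open>j - d\<close> covers the first step in the opposite direction.
\<close>

lemma parks_dom_descent_run:
  assumes "d \<in> {1, -1}" "descent_run (\<lambda>m. \<xi> (j + d * int m)) k"
    and "\<xi> (j - d) < \<xi> j \<Longrightarrow> parks_dom (\<xi>, j - d)"
  shows "parks_dom (\<xi>, j)"
  using assms(2,3)
proof (induction k arbitrary: j)
  case 0
  show ?case
    by (rule parks.domintros) (use 0 assms(1) in auto)
next
  case (Suc k)
  have run: "\<xi> (j + d) < \<xi> j" "descent_run (\<lambda>m. \<xi> (j + d + d * int m)) k"
    using Suc.prems(1) by (auto simp: descent_run_Suc algebra_simps)
  have dom: "parks_dom (\<xi>, j + d)"
    by (rule Suc.IH) (use run in auto)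
  have dom': "parks_dom (\<xi>, j')" if j': "j' \<in> {j - 1, j + 1}" "\<xi> j' < \<xi> j" for j'
  proof (cases "j' = j + d")
    case False
    with j' assms(1) have "j' = j - d" by auto
    with j'(2) Suc.prems(2) show ?thesis by simp
  qed (use dom in simp)
  show ?case by (rule parks.domintros) (rule dom'; simp)+
qed

text \<open>
  Termination is characterised for every configuration, not just almost every one: the event that
  a car parks has to be measurable, and the underlying probability space need not be complete.
\<close>

lemma parks_dom_iff:
  "parks_dom (\<xi>, j) \<longleftrightarrow>
    (\<exists>k. descent_run (\<lambda>m. \<xi> (j + int m)) k) \<and> (\<exists>l. descent_run (\<lambda>m. \<xi> (j - int m)) l)"
proof
  have *: "\<exists>k. descent_run (\<lambda>m. \<xi> (j + d * int m)) k" if "d \<in> {1, -1}" "parks_dom (\<xi>, j)" for d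
    using that(2)
  proof (induction "(\<xi>, j)" arbitrary: j rule: accp_induct_rule)
    case 1
    show ?case
    proof (cases "\<xi> (j + d) < \<xi> j")
      case True
      with that(1) have "parks_rel (\<xi>, j + d) (\<xi>, j)"
        by (auto intro: parks_rel.intros)
      from 1(2)[OF this] obtain k where "descent_run (\<lambda>m. \<xi> (j + d + d * int m)) k"
        by auto
      then have "descent_run (\<lambda>m. \<xi> (j + d * int m)) (Suc k)"
        using True by (simp add: descent_run_Suc algebra_simps)
      then show ?thesis ..
    next
      case False
      then show ?thesis by (intro exI[of _ 0]) simp
    qed
  qed
  show "(\<exists>k. descent_run (\<lambda>m. \<xi> (j + int m)) k) \<and> (\<exists>l. descent_run (\<lambda>m. \<xi> (j - int m)) l)"
    if "parks_dom (\<xi>, j)"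
    using *[of 1] *[of "-1"] that by simp
next
  assume "(\<exists>k. descent_run (\<lambda>m. \<xi> (j + int m)) k) \<and> (\<exists>l. descent_run (\<lambda>m. \<xi> (j - int m)) l)"
  then obtain k l where k: "descent_run (\<lambda>m. \<xi> (j + int m)) k"
    and l: "descent_run (\<lambda>m. \<xi> (j - int m)) l" by blast
  show "parks_dom (\<xi>, j)"
  proof (rule parks_dom_descent_run[of 1])
    assume less: "\<xi> (j - 1) < \<xi> j"
    with l obtain l' where "descent_run (\<lambda>m. \<xi> (j - 1 - int m)) l'"
      by (cases l) (auto simp: descent_run_Suc algebra_simps)
    with less show "parks_dom (\<xi>, j - 1)"
      using parks_dom_descent_run[of "-1" \<xi> "j - 1" l'] by simp
  qed (use k in auto)
qed

text \<open>
  The neighbour \<open>j + 1\<close> is consulted only if its time is smaller than that of \<open>j\<close>; then its run to the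
  left is empty, hence even, and its fate depends on its right run alone. By symmetry
  the same holds for \<open>j - 1\<close>, and the parking rule splits into one condition for each side.
\<close>

lemma parks_iff_even_runs:
  assumes "parks_dom (\<xi>, j)"
  shows "parks \<xi> j \<longleftrightarrow> even_run (\<lambda>m. \<xi> (j + int m)) \<and> even_run (\<lambda>m. \<xi> (j - int m))"
  using assms
proof (induction rule: parks.pinduct)
  case (1 \<xi> j)
  obtain k l where k: "descent_run (\<lambda>m. \<xi> (j + int m)) k"
    and l: "descent_run (\<lambda>m. \<xi> (j - int m)) l"
    using iffD1[OF parks_dom_iff 1(1)] by iprover
  have right: "parks \<xi> (j + 1) \<longleftrightarrow> even_run (\<lambda>m. \<xi> (j + int (Suc m)))" if less: "\<xi> (j + 1) < \<xi> j"
  proof -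
    have "even_run (\<lambda>m. \<xi> (j + 1 - int m))"
      by (rule even_run_trivial) (use less in simp)
    moreover have "(\<lambda>m. \<xi> (j + 1 + int m)) = (\<lambda>m. \<xi> (j + int (Suc m)))"
      by (simp add: algebra_simps)
    ultimately show ?thesis
      unfolding 1(2)[OF insertI2[OF singletonI] less] by simp
  qed
  have left: "parks \<xi> (j - 1) \<longleftrightarrow> even_run (\<lambda>m. \<xi> (j - int (Suc m)))" if less: "\<xi> (j - 1) < \<xi> j"
  proof -
    have "even_run (\<lambda>m. \<xi> (j - 1 + int m))"
      by (rule even_run_trivial) (use less in simp)
    moreover have "(\<lambda>m. \<xi> (j - 1 - int m)) = (\<lambda>m. \<xi> (j - int (Suc m)))"
      by (simp add: algebra_simps)
    ultimately show ?thesis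
      unfolding 1(2)[OF insertI1 less] by simp
  qed
  show ?case
    unfolding parks.psimps[OF 1(1)] even_run_step[OF k] even_run_step[OF l]
    using left right by auto
qed

lemma parked_iff_even_runs:
  "parked \<xi> j \<longleftrightarrow> even_run (\<lambda>m. \<xi> (j + int m)) \<and> even_run (\<lambda>m. \<xi> (j - int m))"
proof (cases "parks_dom (\<xi>, j)")
  case True
  then show ?thesis unfolding parked_def using parks_iff_even_runs by blast
next
  case False
  then show ?thesis unfolding parked_def parks_dom_iff even_run_def by blast
qed

text \<open>
  The left run of the car \<open>i\<close> is either empty or one step longer than that of the car \<open>i - 1\<close>.
  Therefore the later of the two cars parks iff the run on its own side is even and the earlier car has
  failed, while the earlier car parks iff the run on its own side is even. If both of
  these runs are even, the earlier car is the one that parks, and its time is \<open>\<le> t\<close> as soon as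
  either time is. If the two times are equal, both cars may park, with the same arrival time.
\<close>

lemma arrival_le_iff:
  assumes k: "descent_run (\<lambda>m. \<xi> (i + int m)) k"
    and l: "descent_run (\<lambda>m. \<xi> (i - 1 - int m)) l"
  shows "arrival \<xi> i \<le> ereal t \<longleftrightarrow>
    even_run (\<lambda>m. \<xi> (i + int m)) \<and> \<xi> i \<le> t \<or>
    even_run (\<lambda>m. \<xi> (i - 1 - int m)) \<and> \<xi> (i - 1) \<le> t"
proof -
  have eqs: "(\<lambda>m. \<xi> (i - int (Suc m))) = (\<lambda>m. \<xi> (i - 1 - int m))"
    "(\<lambda>m. \<xi> (i - 1 + int (Suc m))) = (\<lambda>m. \<xi> (i + int m))"
    by (auto intro!: arg_cong[of _ _ \<xi>])
  have left: "even_run (\<lambda>m. \<xi> (i - int m)) \<longleftrightarrow>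
      (\<xi> (i - 1) < \<xi> i \<longrightarrow> \<not> even_run (\<lambda>m. \<xi> (i - 1 - int m)))"
  proof (cases "\<xi> (i - 1) < \<xi> i")
    case True
    with l have "descent_run (\<lambda>m. \<xi> (i - int m)) (Suc l)"
      unfolding descent_run_Suc eqs by simp
    from even_run_step[OF this] show ?thesis unfolding eqs by simp
  qed (simp add: even_run_trivial)
  have right: "even_run (\<lambda>m. \<xi> (i - 1 + int m)) \<longleftrightarrow>
      (\<xi> i < \<xi> (i - 1) \<longrightarrow> \<not> even_run (\<lambda>m. \<xi> (i + int m)))"
  proof (cases "\<xi> i < \<xi> (i - 1)")
    case True
    with k have "descent_run (\<lambda>m. \<xi> (i - 1 + int m)) (Suc k)"
      unfolding descent_run_Suc eqs by simp
    from even_run_step[OF this] show ?thesis unfolding eqs by simp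
  qed (simp add: even_run_trivial)
  show ?thesis
    unfolding arrival_def parked_iff_even_runs left right
    by (cases "\<xi> i" "\<xi> (i - 1)" rule: linorder_cases) auto
qed

lemma X_time_eq: "X_time t \<xi> i = (if arrival \<xi> i \<le> ereal t then 1 else 0)"
  by (auto simp: X_time_def X_inf_def arrival_def)

lemma measurable_even_run [measurable (raw)]:
  assumes "\<And>m. (\<lambda>\<omega>. f \<omega> m) \<in> borel_measurable N"
  shows "Measurable.pred N (\<lambda>\<omega>. even_run (f \<omega>))"
proof -
  note assms [measurable]
  show ?thesis unfolding even_run_def descent_run_def by measurable
qed

section \<open>The integral of a power of a continuous distribution function\<close>

text \<open>
  The probability integral transform: for \<open>u < 1\<close> the sublevel set is a closed half-line, and by
  continuity the distribution function takes exactly the value \<open>u\<close> at its endpoint. The half-line can be empty,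
  but only for \<open>u = 0\<close>, since the distribution function tends to \<open>0\<close> on the left.
\<close>

lemma (in real_distribution) prob_cdf_le:
  assumes cont: "continuous_on UNIV (cdf M)" and u: "0 \<le> u" "u \<le> 1"
  shows "measure M {x. cdf M x \<le> u} = u"
proof -
  define S where "S = {x. cdf M x \<le> u}"
  have "closed S"
    unfolding S_def using cont by (intro closed_Collect_le) auto
  consider "u = 1" | "S = {}" | "u < 1" "S \<noteq> {}"
    using u by fastforce
  then have "measure M S = u"
  proof cases
    case 1
    then have "S = UNIV" by (auto simp: S_def cdf_bounded_prob)
    then show ?thesis using 1 prob_space by simp
  next
    case 2
    have "u \<le> cdf M x" for x
      using 2 unfolding S_def by (metis empty_iff le_cases mem_Collect_eq)
    then have "u \<le> 0"
      by (intro tendsto_lowerbound[OF cdf_lim_at_bot]) auto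
    then show ?thesis using 2 u by simp
  next
    case 3
    have "eventually (\<lambda>x. u < cdf M x) at_top"
      using order_tendstoD(1)[OF cdf_lim_at_top_prob 3(1)] .
    then obtain b where b: "\<And>x. x \<ge> b \<Longrightarrow> u < cdf M x"
      by (auto simp: eventually_at_top_linorder)
    have "x \<le> b" if "x \<in> S" for x
      using that b[of x] by (cases "x \<le> b") (auto simp: S_def)
    then have bdd: "bdd_above S" by (rule bdd_aboveI)
    define s where "s = Sup S"
    have "s \<in> S"
      unfolding s_def using 3(2) bdd \<open>closed S\<close> by (rule closed_contains_Sup)
    have S: "S = {..s}"
    proof (intro subset_antisym subsetI)
      fix x assume "x \<in> S"
      then show "x \<in> {..s}" using cSup_upper[OF _ bdd] by (simp add: s_def)
    next
      fix x assume "x \<in> {..s}"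
      with \<open>s \<in> S\<close> show "x \<in> S"
        using cdf_nondecreasing[of x s] by (simp add: S_def)
    qed
    have "u \<le> cdf M s"
    proof (rule tendsto_lowerbound)
      show "(cdf M \<longlongrightarrow> cdf M s) (at_right s)"
        using cdf_is_right_cont[of s] by (simp add: continuous_within)
      have "u < cdf M x" if "s < x" for x
        using that S unfolding S_def by (metis atMost_iff linorder_not_le mem_Collect_eq)
      then show "eventually (\<lambda>x. u \<le> cdf M x) (at_right s)"
        by (auto simp: eventually_at_filter intro!: always_eventually less_imp_le)
    qed simp
    with \<open>s \<in> S\<close> have "cdf M s = u" by (simp add: S_def)
    then show ?thesis unfolding S cdf_def2 .
  qed
  then show ?thesis by (simp add: S_def)
qed

text \<open>
  Since \<open>cdf M\<close> is uniform on \<open>[0, 1]\<close> under \<open>M\<close>, this is the integral of \<open>u ^ k\<close> over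
  \<open>[0, cdf M t]\<close>.
\<close>

lemma (in real_distribution) nn_integral_cdf_power:
  assumes cont: "continuous_on UNIV (cdf M)"
  shows "(\<integral>\<^sup>+x. ennreal (cdf M x ^ k) * indicator {..<t} x \<partial>M)
    = ennreal (cdf M t ^ Suc k / real (Suc k))"
proof -
  have [measurable]: "cdf M \<in> borel_measurable borel"
    using cont by (rule borel_measurable_continuous_onI)
  have bounds: "0 \<le> cdf M t" "cdf M t \<le> 1"
    by (simp_all add: cdf_nonneg cdf_bounded_prob)
  have unif: "distributed M lborel (cdf M) (indicator {0..1})"
    using uniform_distrI_borel_atLeastAtMost[of "cdf M" 0 1] by (simp add: prob_cdf_le[OF cont] ennreal_indicator)
  \<comment> \<open>Where \<open>cdf M\<close> is constant to the right of \<open>t\<close>, the conditions \<open>x < t\<close> and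
    \<open>cdf M x \<le> cdf M t\<close> differ, but such a piece carries no mass.\<close>
  have "measure M ({x. cdf M x \<le> cdf M t} - {..t}) = measure M {x. cdf M x \<le> cdf M t} - measure M {..t}"
    by (rule finite_measure_Diff) (auto intro: cdf_nondecreasing)
  also have "\<dots> = 0"
    using prob_cdf_le[OF cont bounds] by (simp add: cdf_def2)
  finally have "AE x in M. x \<notin> {x. cdf M x \<le> cdf M t} - {..t}"
    by (subst prob_eq_0[symmetric]) (auto)
  moreover have "AE x in M. x \<notin> {t}"
  proof (subst prob_eq_0[symmetric])
    have "isCont (cdf M) t" using cont by (simp add: continuous_on_eq_continuous_at)
    then show "measure M {t} = 0" by (simp add: isCont_cdf)
  qed auto
  ultimately have AE: "AE x in M. x < t \<longleftrightarrow> cdf M x \<le> cdf M t"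
    by eventually_elim (auto intro: cdf_nondecreasing)
  have "(\<integral>\<^sup>+x. ennreal (cdf M x ^ k) * indicator {..<t} x \<partial>M) =
        (\<integral>\<^sup>+x. ennreal (cdf M x ^ k) * indicator {..cdf M t} (cdf M x) \<partial>M)"
    using AE by (intro nn_integral_cong_AE) (auto split: split_indicator elim!: eventually_mono)
  also have "\<dots> = (\<integral>\<^sup>+u. indicator {0..1} u *
      (ennreal (u ^ k) * indicator {..cdf M t} u) \<partial>lborel)"
    by (rule distributed_nn_integral[OF unif, symmetric]) simp
  also have "\<dots> = (\<integral>\<^sup>+u. ennreal (u ^ k) * indicator {0..cdf M t} u \<partial>lborel)"
    using bounds by (intro nn_integral_cong) (auto split: split_indicator)
  also have "\<dots> = ennreal (cdf M t ^ Suc k / real (Suc k) - 0 ^ Suc k / real (Suc k))"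
  proof (rule nn_integral_FTC_Icc)
    show "((\<lambda>u. u ^ Suc k / real (Suc k)) has_real_derivative u ^ k) (at u)" for u :: real
      using DERIV_cdivide[OF DERIV_pow[of "Suc k" u], of "real (Suc k)"] by (simp del: of_nat_Suc)
  qed (use bounds in auto)
  finally show ?thesis by simp
qed

section \<open>Descending runs of i.i.d. continuous times\<close>

text \<open>
  Conditioning on \<open>X\<close>: by independence, its value may be drawn first and then be held fixed while
  \<open>Y\<close> is drawn.
\<close>

lemma (in prob_space) emeasure_indep_var:
  assumes indep: "indep_var S X T Y"
    and Q [measurable]: "Measurable.pred (S \<Otimes>\<^sub>M T) (\<lambda>(x, y). Q x y)"
  shows "emeasure M {\<omega> \<in> space M. Q (X \<omega>) (Y \<omega>)}
    = (\<integral>\<^sup>+\<omega>'. emeasure M {\<omega> \<in> space M. Q (X \<omega>') (Y \<omega>)} \<partial>M)"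
proof -
  have [measurable]: "X \<in> measurable M S" "Y \<in> measurable M T"
    using indep_var_rv1[OF indep] indep_var_rv2[OF indep] by auto
  interpret Y: prob_space "distr M T Y" by (rule prob_space_distr) simp
  let ?A = "{z \<in> space (S \<Otimes>\<^sub>M T). case z of (x, y) \<Rightarrow> Q x y}"
  have A: "?A \<in> sets (S \<Otimes>\<^sub>M T)" by simp
  have spaces: "X \<omega> \<in> space S" "Y \<omega> \<in> space T" if "\<omega> \<in> space M" for \<omega>
    using that measurable_space[of X M S] measurable_space[of Y M T] by simp_all
  have "emeasure M {\<omega> \<in> space M. Q (X \<omega>) (Y \<omega>)} = emeasure (distr M (S \<Otimes>\<^sub>M T) (\<lambda>\<omega>. (X \<omega>, Y \<omega>))) ?A"
    by (subst emeasure_distr)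
       (auto intro!: arg_cong2[where f=emeasure] simp: space_pair_measure spaces)
  also have "distr M (S \<Otimes>\<^sub>M T) (\<lambda>\<omega>. (X \<omega>, Y \<omega>)) = distr M S X \<Otimes>\<^sub>M distr M T Y"
    using indep by (simp add: indep_var_distribution_eq)
  also have "emeasure \<dots> ?A = (\<integral>\<^sup>+x. emeasure (distr M T Y) (Pair x -` ?A) \<partial>distr M S X)"
    by (rule Y.emeasure_pair_measure_alt) (use A in simp)
  also have "\<dots> = (\<integral>\<^sup>+\<omega>'. emeasure (distr M T Y) (Pair (X \<omega>') -` ?A) \<partial>M)"
    using Y.measurable_emeasure_Pair[of ?A S] A by (intro nn_integral_distr) simp_all
  also have "\<dots> = (\<integral>\<^sup>+\<omega>'. emeasure M {\<omega> \<in> space M. Q (X \<omega>') (Y \<omega>)} \<partial>M)"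
  proof (rule nn_integral_cong)
    fix \<omega>' assume "\<omega>' \<in> space M"
    then show "emeasure (distr M T Y) (Pair (X \<omega>') -` ?A) = emeasure M {\<omega> \<in> space M. Q (X \<omega>') (Y \<omega>)}"
      using sets_Pair1[OF A, of "X \<omega>'"]
      by (subst emeasure_distr)
         (auto intro!: arg_cong2[where f=emeasure] simp: space_pair_measure spaces)
  qed
  finally show ?thesis .
qed

text \<open>
  The index type is arbitrary; runs are read along an injective sequence \<open>s\<close> of indices, so that
  the walks to the right and to the left of a place are instances of the same statements.
\<close>

locale iid_continuous = prob_space M for M :: "'a measure" +
  fixes \<xi> :: "'i \<Rightarrow> 'a \<Rightarrow> real" and F :: "real \<Rightarrow> real"
  assumes indep: "indep_vars (\<lambda>_. borel) \<xi> UNIV"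
    and cdf_eq: "\<And>j. cdf (distr M borel (\<xi> j)) = F"
    and cont: "continuous_on UNIV F"
begin

lemma measurable_xi [measurable]: "\<xi> j \<in> borel_measurable M"
  using indep by (simp add: indep_vars_def)

lemma real_distribution_xi: "real_distribution (distr M borel (\<xi> j))"
  by (simp add: real_distribution_distr)

lemma measurable_F [measurable]: "F \<in> borel_measurable borel"
  using cont by (rule borel_measurable_continuous_onI)

lemma F_bounds: "0 \<le> F t" "F t \<le> 1"
proof -
  interpret D: real_distribution "distr M borel (\<xi> undefined)" by (rule real_distribution_xi)
  show "0 \<le> F t" "F t \<le> 1"
    using D.cdf_nonneg[of t] D.cdf_bounded_prob[of t] by (simp_all add: cdf_eq)
qed

lemma AE_xi_neq: "AE \<omega> in M. \<xi> j \<omega> \<noteq> t"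
proof -
  interpret D: real_distribution "distr M borel (\<xi> j)" by (rule real_distribution_xi)
  have "isCont F t" using cont by (simp add: continuous_on_eq_continuous_at)
  then have "measure (distr M borel (\<xi> j)) {t} = 0"
    using D.isCont_cdf[of t] by (simp add: cdf_eq)
  then have "AE x in distr M borel (\<xi> j). x \<notin> {t}"
    by (subst D.prob_eq_0[symmetric]) auto
  then show ?thesis by (simp add: AE_distr_iff)
qed

text \<open>
  Given \<open>\<xi> (s 0) = x < t\<close>, the rest of the descent is a descent of length \<open>k\<close> that starts below
  \<open>x\<close>, so the induction step integrates the previous formula against the law of \<open>\<xi> (s 0)\<close>. The
  strict bound \<open>< t\<close> on the first time makes the induction hypothesis fit literally.
\<close>

lemma emeasure_descents:
  assumes "inj s"
  shows "emeasure M {\<omega> \<in> space M. \<xi> (s 0) \<omega> < t \<and> (\<forall>m<k. \<xi> (s (Suc m)) \<omega> < \<xi> (s m) \<omega>)}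
    = ennreal (F t ^ Suc k / fact (Suc k))"
  using assms
proof (induction k arbitrary: s t)
  case 0
  interpret D: real_distribution "distr M borel (\<xi> (s 0))" by (rule real_distribution_xi)
  show ?case
    using D.nn_integral_cdf_power[of 0 t] cont by (simp add: cdf_eq emeasure_distr vimage_def Int_def conj_commute)
next
  case (Suc k)
  interpret D: real_distribution "distr M borel (\<xi> (s 0))" by (rule real_distribution_xi)
  define B where "B = range (\<lambda>m. s (Suc m))"
  have sB: "s (Suc m) \<in> B" for m by (simp add: B_def)
  have comp [measurable]: "(\<lambda>y. y (s (Suc m))) \<in> borel_measurable (PiM B (\<lambda>_. borel))" for m
    by (rule measurable_component_singleton[OF sB])
  \<comment> \<open>The first time is taken as a function on the singleton index set, because \<open>indep_var\<close> requires both
    variables to have the same type.\<close>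
  have [measurable]: "(\<lambda>x. x (s 0)) \<in> borel_measurable (PiM {s 0} (\<lambda>_. borel))"
    by (rule measurable_component_singleton) simp
  have ind: "indep_var (PiM {s 0} (\<lambda>_. borel)) (\<lambda>\<omega>. restrict (\<lambda>j. \<xi> j \<omega>) {s 0})
      (PiM B (\<lambda>_. borel)) (\<lambda>\<omega>. restrict (\<lambda>j. \<xi> j \<omega>) B)"
    by (rule indep_var_restrict[OF indep]) (use Suc.prems in \<open>auto simp: B_def inj_eq\<close>)
  have IH: "emeasure M {\<omega> \<in> space M. \<xi> (s (Suc 0)) \<omega> < x \<and>
      (\<forall>m<k. \<xi> (s (Suc (Suc m))) \<omega> < \<xi> (s (Suc m)) \<omega>)} = ennreal (F x ^ Suc k / fact (Suc k))" for x
    by (rule Suc.IH) (use Suc.prems in \<open>auto intro!: injI dest: injD\<close>)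
  have "emeasure M {\<omega> \<in> space M. \<xi> (s 0) \<omega> < t \<and> (\<forall>m<Suc k. \<xi> (s (Suc m)) \<omega> < \<xi> (s m) \<omega>)}
    = emeasure M {\<omega> \<in> space M. \<xi> (s 0) \<omega> < t \<and> restrict (\<lambda>j. \<xi> j \<omega>) B (s (Suc 0)) < \<xi> (s 0) \<omega> \<and>
       (\<forall>m<k. restrict (\<lambda>j. \<xi> j \<omega>) B (s (Suc (Suc m))) < restrict (\<lambda>j. \<xi> j \<omega>) B (s (Suc m)))}"
    by (intro arg_cong2[where f=emeasure]) (auto simp: sB All_less_Suc2)
  also have "\<dots> = (\<integral>\<^sup>+\<omega>'. emeasure M {\<omega> \<in> space M. \<xi> (s 0) \<omega>' < t \<and> restrict (\<lambda>j. \<xi> j \<omega>) B (s (Suc 0)) < \<xi> (s 0) \<omega>' \<and>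
       (\<forall>m<k. restrict (\<lambda>j. \<xi> j \<omega>) B (s (Suc (Suc m))) < restrict (\<lambda>j. \<xi> j \<omega>) B (s (Suc m)))} \<partial>M)"
    using emeasure_indep_var[OF ind, of "\<lambda>x y. x (s 0) < t \<and> y (s (Suc 0)) < x (s 0) \<and>
      (\<forall>m<k. y (s (Suc (Suc m))) < y (s (Suc m)))"] by simp
  also have "\<dots> = (\<integral>\<^sup>+\<omega>. ennreal (1 / fact (Suc k)) * (ennreal (F (\<xi> (s 0) \<omega>) ^ Suc k) * indicator {..<t} (\<xi> (s 0) \<omega>)) \<partial>M)"
    by (intro nn_integral_cong)
       (simp add: sB IH F_bounds ennreal_mult'[symmetric] split: split_indicator del: power_Suc fact_Suc)
  also have "\<dots> = (\<integral>\<^sup>+x. ennreal (1 / fact (Suc k)) * (ennreal (F x ^ Suc k) * indicator {..<t} x) \<partial>distr M borel (\<xi> (s 0)))"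
    by (subst nn_integral_distr) simp_all
  also have "\<dots> = ennreal (1 / fact (Suc k)) * ennreal (F t ^ Suc (Suc k) / real (Suc (Suc k)))"
    using D.nn_integral_cdf_power[of "Suc k" t] cont
    by (subst nn_integral_cmult) (simp_all add: cdf_eq)
  also have "\<dots> = ennreal (F t ^ Suc (Suc k) / fact (Suc (Suc k)))"
    by (simp add: ennreal_mult'[symmetric] F_bounds field_simps)
  finally show ?case .
qed

text \<open>
  A run has length exactly \<open>2 * n\<close> if there are \<open>2 * n\<close> descents but not \<open>2 * n + 1\<close>. Summing the
  differences of the corresponding probabilities over \<open>n\<close> gives the exponential series of
  \<open>exp (- F t)\<close> without its constant term and with the opposite sign, its terms grouped in pairs.
\<close>

lemma prob_even_run:
  assumes "inj s"
  shows "prob {\<omega> \<in> space M. \<xi> (s 0) \<omega> < t \<and> even_run (\<lambda>m. \<xi> (s m) \<omega>)} = 1 - exp (- F t)"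
proof -
  define E where "E k = {\<omega> \<in> space M. \<xi> (s 0) \<omega> < t \<and> (\<forall>m<k. \<xi> (s (Suc m)) \<omega> < \<xi> (s m) \<omega>)}" for k
  have [measurable]: "E k \<in> sets M" for k
    unfolding E_def by measurable
  have prob_E: "prob (E k) = F t ^ Suc k / fact (Suc k)" for k
    using emeasure_descents[OF assms, of t k] F_bounds[of t] unfolding E_def
    by (simp add: measure_def)
  define A where "A n = E (2 * n) - E (Suc (2 * n))" for n
  have [measurable]: "A n \<in> sets M" for n
    unfolding A_def by measurable
  have A: "A n = {\<omega> \<in> space M. \<xi> (s 0) \<omega> < t \<and> descent_run (\<lambda>m. \<xi> (s m) \<omega>) (2 * n)}" for n
    by (auto simp: A_def E_def descent_run_def less_Suc_eq)
  have disj: "disjoint_family A"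
    using descent_run_unique by (fastforce simp: disjoint_family_on_def A)
  have prob_A: "prob (A n) = prob (E (2 * n)) - prob (E (Suc (2 * n)))" for n
    unfolding A_def by (rule finite_measure_Diff) (auto simp: E_def)
  have "(\<lambda>n. prob (A n)) sums prob (\<Union>n. A n)"
    by (rule finite_measure_UNION) (use disj in auto)
  also have "(\<Union>n. A n) = {\<omega> \<in> space M. \<xi> (s 0) \<omega> < t \<and> even_run (\<lambda>m. \<xi> (s m) \<omega>)}"
    by (auto simp: A even_run_def elim!: evenE) (metis dvd_triv_left)
  finally have 1: "(\<lambda>n. prob (A n)) sums prob {\<omega> \<in> space M. \<xi> (s 0) \<omega> < t \<and> even_run (\<lambda>m. \<xi> (s m) \<omega>)}" .
  have "(\<lambda>n. (- F t) ^ n / fact n) sums exp (- F t)"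
    using exp_converges[of "- F t"] by (simp add: field_simps)
  then have "(\<lambda>n. (- F t) ^ Suc n / fact (Suc n)) sums (exp (- F t) - 1)"
    by (subst sums_Suc_iff) simp
  then have "(\<lambda>n. - ((- F t) ^ Suc n / fact (Suc n))) sums (1 - exp (- F t))"
    using sums_minus by fastforce
  from sums_group[OF this, of 2]
  have "(\<lambda>n. prob (A n)) sums (1 - exp (- F t))"
    by (simp add: prob_A prob_E mult.commute)
  with 1 show ?thesis by (rule sums_unique2)
qed

text \<open>
  An infinite descent that starts below \<open>N\<close> contains descents of every length \<open>k\<close>, whose probabilities
  tend to \<open>0\<close>; and every first time lies below some natural number \<open>N\<close>.
\<close>

lemma AE_descent_run:
  assumes "inj s"
  shows "AE \<omega> in M. \<exists>k. descent_run (\<lambda>m. \<xi> (s m) \<omega>) k"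
proof -
  have "AE \<omega> in M. \<not> (\<xi> (s 0) \<omega> < real N \<and> (\<forall>m. \<xi> (s (Suc m)) \<omega> < \<xi> (s m) \<omega>))" for N
  proof -
    define D where "D = {\<omega> \<in> space M. \<xi> (s 0) \<omega> < real N \<and> (\<forall>m. \<xi> (s (Suc m)) \<omega> < \<xi> (s m) \<omega>)}"
    have [measurable]: "D \<in> sets M" unfolding D_def by measurable
    have le: "prob D \<le> F (real N) ^ Suc k / fact (Suc k)" for k
    proof -
      have "emeasure M D \<le> ennreal (F (real N) ^ Suc k / fact (Suc k))"
        unfolding emeasure_descents[OF assms, symmetric]
        by (rule emeasure_mono) (auto simp: D_def)
      then show ?thesis
        by (simp add: emeasure_eq_measure F_bounds)
    qed
    have "(\<lambda>n. F (real N) ^ n / fact n) \<longlonglongrightarrow> 0"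
      using summable_LIMSEQ_zero[OF summable_exp[of "F (real N)"]] by (simp add: field_simps)
    then have "(\<lambda>k. F (real N) ^ Suc k / fact (Suc k)) \<longlonglongrightarrow> 0"
      by (rule LIMSEQ_Suc)
    then have "prob D \<le> 0"
      by (rule tendsto_lowerbound) (use le in auto)
    then have "prob D = 0" by (simp add: measure_le_0_iff)
    then have "AE \<omega> in M. \<omega> \<notin> D" by (simp add: prob_eq_0)
    then show ?thesis by (auto simp: D_def elim!: eventually_mono AE_mp intro!: AE_I2)
  qed
  then have "AE \<omega> in M. \<forall>N. \<not> (\<xi> (s 0) \<omega> < real N \<and> (\<forall>m. \<xi> (s (Suc m)) \<omega> < \<xi> (s m) \<omega>))"
    unfolding AE_all_countable by blast
  then show ?thesis
  proof eventually_elim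
    case (elim \<omega>)
    obtain N where "\<xi> (s 0) \<omega> < real N" using reals_Archimedean2 by blast
    with elim have "\<exists>m. \<not> \<xi> (s (Suc m)) \<omega> < \<xi> (s m) \<omega>" by blast
    then show ?case
      unfolding descent_run_def by (rule exists_least_iff[THEN iffD1, elim_format]) blast
  qed
qed

text \<open>
  The two events are determined by disjoint sets of coordinates, hence independent. They are pulled
  back from the product space \<open>PiM (range s) (\<lambda>_. borel)\<close>, where independence of the two restrictions of
  the family is available.
\<close>

lemma prob_even_run_disj:
  assumes "inj s" "inj s'" "range s \<inter> range s' = {}"
  shows "prob {\<omega> \<in> space M. \<xi> (s 0) \<omega> < t \<and> even_run (\<lambda>m. \<xi> (s m) \<omega>) \<or>
      \<xi> (s' 0) \<omega> < t \<and> even_run (\<lambda>m. \<xi> (s' m) \<omega>)} = 1 - exp (- 2 * F t)"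
proof -
  define A where "A s = {\<omega> \<in> space M. \<xi> (s 0) \<omega> < t \<and> even_run (\<lambda>m. \<xi> (s m) \<omega>)}" for s
  have [measurable]: "A s \<in> sets M" for s
    unfolding A_def by measurable
  define P where "P s = {x \<in> space (PiM (range s) (\<lambda>_. borel)). x (s 0) < t \<and> even_run (\<lambda>m. x (s m))}"
    for s :: "nat \<Rightarrow> 'i"
  have P: "P s \<in> sets (PiM (range s) (\<lambda>_. borel))" for s
  proof -
    have [measurable]: "(\<lambda>x. x (s m)) \<in> borel_measurable (PiM (range s) (\<lambda>_. borel))" for m
      by (rule measurable_component_singleton) simp
    show ?thesis unfolding P_def by measurable
  qed
  have vimage: "restrict (\<lambda>j. \<xi> j \<omega>) (range s) \<in> P s \<longleftrightarrow> \<omega> \<in> A s" if "\<omega> \<in> space M" for s \<omega>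
    using that by (simp add: P_def A_def space_PiM)
  have "prob ((\<lambda>\<omega>. (restrict (\<lambda>j. \<xi> j \<omega>) (range s), restrict (\<lambda>j. \<xi> j \<omega>) (range s'))) -` (P s \<times> P s') \<inter> space M) =
    prob ((\<lambda>\<omega>. restrict (\<lambda>j. \<xi> j \<omega>) (range s)) -` P s \<inter> space M) *
    prob ((\<lambda>\<omega>. restrict (\<lambda>j. \<xi> j \<omega>) (range s')) -` P s' \<inter> space M)"
    by (rule indep_varD[OF indep_var_restrict[OF indep assms(3)] P P]) auto
  also have "(\<lambda>\<omega>. (restrict (\<lambda>j. \<xi> j \<omega>) (range s), restrict (\<lambda>j. \<xi> j \<omega>) (range s'))) -` (P s \<times> P s') \<inter> space M = A s \<inter> A s'"
    using vimage by (auto simp: A_def)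
  also have "(\<lambda>\<omega>. restrict (\<lambda>j. \<xi> j \<omega>) (range s)) -` P s \<inter> space M = A s"
    using vimage by (auto simp: A_def)
  also have "(\<lambda>\<omega>. restrict (\<lambda>j. \<xi> j \<omega>) (range s')) -` P s' \<inter> space M = A s'"
    using vimage by (auto simp: A_def)
  finally have "prob (A s \<inter> A s') = (1 - exp (- F t)) * (1 - exp (- F t))"
    using prob_even_run[OF assms(1)] prob_even_run[OF assms(2)] by (simp add: A_def)
  moreover have "prob (A s \<union> A s') = prob (A s) + prob (A s') - prob (A s \<inter> A s')"
    by (rule measure_Un3) (auto simp: fmeasurable_eq_sets)
  ultimately have "prob (A s \<union> A s') = 1 - exp (- F t) * exp (- F t)"
    using prob_even_run[OF assms(1)] prob_even_run[OF assms(2)] by (simp add: A_def algebra_simps)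
  moreover have "A s \<union> A s' = {\<omega> \<in> space M. \<xi> (s 0) \<omega> < t \<and> even_run (\<lambda>m. \<xi> (s m) \<omega>) \<or>
      \<xi> (s' 0) \<omega> < t \<and> even_run (\<lambda>m. \<xi> (s' m) \<omega>)}"
    by (auto simp: A_def)
  ultimately show ?thesis by (simp add: exp_add[symmetric])
qed

end

section \<open>The law of the arrival time\<close>

text \<open>
  Together with \<open>parked_iff_even_runs\<close>, this gives the measurability of the event.
\<close>

lemma arrival_le_parked:
  "arrival \<xi> i \<le> ereal t \<longleftrightarrow>
    parked \<xi> (i - 1) \<and> \<xi> (i - 1) \<le> t \<or> \<not> parked \<xi> (i - 1) \<and> parked \<xi> i \<and> \<xi> i \<le> t"
  by (simp add: arrival_def)

theorem theorem5:
  fixes M :: "'a measure" and \<xi> :: "int \<Rightarrow> 'a \<Rightarrow> real" and F :: "real \<Rightarrow> real"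
    and i :: int and t :: real
  assumes "prob_space M"
    and "prob_space.indep_vars M (\<lambda>_. borel) \<xi> UNIV"
    and "\<And>j. cdf (distr M borel (\<xi> j)) = F"
    and "continuous_on UNIV F"
    and "\<And>j. AE \<omega> in M. 0 \<le> \<xi> j \<omega>"
    and "0 \<le> t"
  shows "(LINT \<omega>|M. X_time t (\<lambda>j. \<xi> j \<omega>) i)
           = measure M {\<omega> \<in> space M. arrival (\<lambda>j. \<xi> j \<omega>) i \<le> ereal t}
         \<and> measure M {\<omega> \<in> space M. arrival (\<lambda>j. \<xi> j \<omega>) i \<le> ereal t} = 1 - exp (- 2 * F t)"
proof
  interpret prob_space M by fact
  interpret iid_continuous M \<xi> F
    by unfold_locales (use assms in auto)
  have arr [measurable]: "{\<omega> \<in> space M. arrival (\<lambda>j. \<xi> j \<omega>) i \<le> ereal t} \<in> sets M" (is "?A \<in> _")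
    unfolding arrival_le_parked parked_iff_even_runs by measurable
  have "(LINT \<omega>|M. X_time t (\<lambda>j. \<xi> j \<omega>) i) = (LINT \<omega>|M. indicator ?A \<omega>)"
    by (intro Bochner_Integration.integral_cong) (auto simp: X_time_eq)
  then show "(LINT \<omega>|M. X_time t (\<lambda>j. \<xi> j \<omega>) i) = prob ?A"
    by simp
  let ?R = "\<lambda>m. i + int m" and ?L = "\<lambda>m. i - 1 - int m"
  have inj: "inj ?R" "inj ?L" and disj: "range ?R \<inter> range ?L = {}"
    by (auto simp: inj_def)
  \<comment> \<open>Passing from \<open>\<le> t\<close> to \<open>< t\<close> costs nothing since the times have no atoms.\<close>
  have "prob ?A = prob {\<omega> \<in> space M. \<xi> (?R 0) \<omega> < t \<and> even_run (\<lambda>m. \<xi> (?R m) \<omega>) \<or>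
      \<xi> (?L 0) \<omega> < t \<and> even_run (\<lambda>m. \<xi> (?L m) \<omega>)}"
  proof (rule finite_measure_eq_AE)
    show "AE \<omega> in M. \<omega> \<in> ?A \<longleftrightarrow> \<omega> \<in> {\<omega> \<in> space M. \<xi> (?R 0) \<omega> < t \<and> even_run (\<lambda>m. \<xi> (?R m) \<omega>) \<or>
      \<xi> (?L 0) \<omega> < t \<and> even_run (\<lambda>m. \<xi> (?L m) \<omega>)}"
      using AE_descent_run[OF inj(1)] AE_descent_run[OF inj(2)]
        AE_xi_neq[of i t] AE_xi_neq[of "i - 1" t]
    proof eventually_elim
      case (elim \<omega>)
      then obtain k l where "descent_run (\<lambda>m. \<xi> (i + int m) \<omega>) k" "descent_run (\<lambda>m. \<xi> (i - 1 - int m) \<omega>) l"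
        by blast
      from arrival_le_iff[of "\<lambda>j. \<xi> j \<omega>", OF this, of t] elim(3,4) show ?case
        by auto
    qed
  qed (use arr in measurable)
  also have "\<dots> = 1 - exp (- 2 * F t)"
    by (rule prob_even_run_disj[OF inj disj])
  finally show "prob ?A = 1 - exp (- 2 * F t)" .
qed

end
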